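(* For all integers $d\ge 1$, the quantity $\mathcal{L}(d)$ is finite, where $\mathcal{L}(d):=\sup\{n_A : A\in\mathcal{A}_d\}$, $\mathcal{A}_d$ is the collection of matrices $A\in M_d(\mathbb{Z})$ for which there exists a positive integer $n$ such that $A^n$ has integer eigenvalues, and for $A\in\mathcal{A}_d$, $n_A$ is the minimum such $n$.
   Context: $M_d(\mathbb{Z})$ denotes the $d\times d$ integer matrices. "$A^n$ has integer eigenvalues" means that all complex eigenvalues of $A^n$ are integers. *)

theory Defs
  imports
    "Jordan_Normal_Form.Char_Poly"
    "HOL-Library.Extended_Nat"
    Complex_Main
begin

definition has_integer_eigenvalues :: "int mat \<Rightarrow> bool" where
  "has_integer_eigenvalues B \<longleftrightarrow>
     (\<forall>z::complex. eigenvalue (map_mat complex_of_int B) z \<longrightarrow> z \<in> \<int>)"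

definition eventually_integral_mats :: "nat \<Rightarrow> int mat set" where
  "eventually_integral_mats d =
     {A \<in> carrier_mat d d. \<exists>n::nat. n > 0 \<and> has_integer_eigenvalues (A ^\<^sub>m n)}"

text \<open>Only meaningful for members of some \<^const>\<open>eventually_integral_mats\<close>;
  otherwise the minimum does not exist.\<close>

definition min_integral_power :: "int mat \<Rightarrow> nat" where
  "min_integral_power A = (LEAST n. n > 0 \<and> has_integer_eigenvalues (A ^\<^sub>m n))"

text \<open>The supremum is taken in \<^typ>\<open>enat\<close>, where an unbounded set has supremum \<open>\<infinity>\<close>;
  on \<^typ>\<open>nat\<close> it would be an unspecified number and finiteness would say nothing.\<close>

definition max_integral_power :: "nat \<Rightarrow> enat" where
  "max_integral_power d = (SUP A\<in>eventually_integral_mats d. enat (min_integral_power A))"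

end

theory Submission
  imports Defs "Jordan_Normal_Form.Schur_Decomposition"
begin

text \<open>
  Let \<open>x \<noteq> 0\<close> be an eigenvalue of an integer \<open>d \<times> d\<close> matrix \<open>A\<close> with \<open>x ^ n = a\<close> an
  integer. All conjugates of \<open>x\<close> are roots of \<open>X ^ n - a\<close>, so they differ from \<open>x\<close> by roots of
  unity. Multiplying them together shows that \<open>x ^ k = c * w\<close>, where \<open>k \<le> d\<close> is the degree of
  \<open>x\<close>, \<open>c\<close> is an integer (up to sign the norm of \<open>x\<close>), and \<open>w\<close> is a root of unity:
  \<open>power_degree_eq_int_times_root_of_unity\<close>. The exponent \<open>n\<close> may be huge, but \<open>k\<close> is not, and
  the order of \<open>w\<close> is not either: \<open>c * w\<close> is an eigenvalue of the integer matrix \<open>A ^ k\<close>, so \<open>w\<close>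
  is a root of a nonzero integer polynomial of degree \<open>d\<close>.

  There are only finitely many roots of unity of degree at most \<open>d\<close>
  (\<open>finite_roots_of_unity_deg\<close>). This is Kronecker's argument: the minimal polynomial of a root of
  unity has all its complex roots on the unit circle, so its integer coefficients are bounded in
  terms of the degree. Hence one exponent \<open>M\<close>, depending on \<open>d\<close> only, kills all of them, and
  \<open>x ^ (k * M) = c ^ M\<close> is an integer. As \<open>k\<close> divides \<open>d!\<close>, the power \<open>A ^ (d! * M)\<close> has integer
  eigenvalues for every \<open>A\<close> in the collection, since the eigenvalues of a power of \<open>A\<close> are the
  powers of the eigenvalues of \<open>A\<close> (\<open>eigenvalue_pow_mat_iff\<close>).
\<close>

section \<open>Minimal integer polynomials\<close>

text \<open>
  A primitive polynomial of least degree does the job: pseudo-division leaves a remainder of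
  smaller degree with the same root, hence zero, and Gauss's lemma removes the scalar that
  pseudo-division introduces. Divisibility over the integers, rather than the rationals, is what
  makes the minimal polynomial of an algebraic integer monic up to sign.
\<close>

lemma minimal_int_poly:
  fixes z :: complex
  assumes "f \<noteq> 0" and "poly (of_int_poly f) z = 0"
  obtains p :: "int poly" where "content p = 1" and "poly (of_int_poly p) z = 0"
    and "\<And>q. poly (of_int_poly q) z = 0 \<Longrightarrow> p dvd q"
proof -
  define R where "R q \<longleftrightarrow> q \<noteq> 0 \<and> poly (of_int_poly q) z = 0" for q :: "int poly"
  define f' where "f' = arg_min degree R"
  have "R f"
    using assms by (simp add: R_def)
  then have f': "R f'" and min: "R q \<Longrightarrow> degree f' \<le> degree q" for q
    unfolding f'_def by (auto intro: arg_min_natI arg_min_nat_le)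
  define p where "p = primitive_part f'"
  have "f' \<noteq> 0" using f' by (simp add: R_def)
  then have p0: "p \<noteq> 0" and prim: "content p = 1"
    by (simp_all add: p_def)
  have "of_int_poly f' = (Polynomial.smult (of_int (content f')) (of_int_poly p) :: complex poly)"
    unfolding p_def by (metis content_times_primitive_part of_int_hom.map_poly_hom_smult)
  then have pz: "poly (of_int_poly p) z = 0"
    using f' \<open>f' \<noteq> 0\<close> by (simp add: R_def)
  have "p dvd q" if q: "poly (of_int_poly q) z = 0" for q
  proof -
    obtain a s where a: "a \<noteq> 0" and eq: "Polynomial.smult a q = p * s + pseudo_mod q p"
      using pseudo_mod(1)[OF p0] by blast
    have "poly (of_int_poly (Polynomial.smult a q)) z = poly (of_int_poly (p * s + pseudo_mod q p)) z"
      by (simp only: eq)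
    then have "poly (of_int_poly (pseudo_mod q p)) z = 0"
      using q pz by (simp add: hom_distribs)
    moreover have "pseudo_mod q p = 0 \<or> degree (pseudo_mod q p) < degree f'"
      using pseudo_mod(2)[OF p0, of q] by (simp add: p_def)
    ultimately have "pseudo_mod q p = 0"
      using min[of "pseudo_mod q p"] by (metis R_def not_less)
    then have eq: "Polynomial.smult a q = p * s" using eq by simp
    then have "content (Polynomial.smult a q) = content s"
      by (simp add: content_mult prim)
    then have "a dvd content s"
      by (metis content_smult dvd_normalize_iff dvd_triv_left normalize_dvd_iff)
    then have "[:a:] dvd s"
      by (simp only: const_poly_dvd_iff_dvd_content)
    then obtain t where "s = [:a:] * t"
      by (rule dvdE)
    then have "s = Polynomial.smult a t"
      by simp
    then have "Polynomial.smult a q = Polynomial.smult a (p * t)" using eq by simp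
    then show "p dvd q" using a by (metis dvd_triv_left smult_cancel)
  qed
  with prim pz show thesis by (rule that)
qed

section \<open>Roots of unity of bounded degree\<close>

text \<open>Each linear factor at most doubles the largest coefficient.\<close>

lemma norm_coeff_prod_linear_le:
  fixes as :: "complex list"
  assumes "\<forall>a\<in>set as. norm a \<le> 1"
  shows "norm (coeff (\<Prod>a\<leftarrow>as. [:- a, 1:]) i) \<le> 2 ^ length as"
  using assms
proof (induction as arbitrary: i)
  case Nil
  then show ?case by (cases i) auto
next
  case (Cons a as)
  let ?P = "\<Prod>a\<leftarrow>as. [:- a, 1:]"
  have IH: "norm (coeff ?P j) \<le> 2 ^ length as" for j
    using Cons by simp
  have 1: "norm (a * coeff ?P i) \<le> 2 ^ length as"
    using mult_mono[of "norm a" 1 "norm (coeff ?P i)" "2 ^ length as"] IH[of i] Cons.prems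
    by (simp add: norm_mult)
  show ?case
  proof (cases i)
    case 0
    have "norm (a * coeff ?P i) \<le> 2 * 2 ^ length as"
      using 1 by (rule order_trans) simp
    then show ?thesis
      using 0 by simp
  next
    case (Suc j)
    have "norm (coeff ?P j - a * coeff ?P i) \<le> 2 ^ length as + 2 ^ length as"
      using norm_triangle_ineq4[of "coeff ?P j" "a * coeff ?P i"] 1 IH[of j] by linarith
    then show ?thesis
      using Suc by simp
  qed
qed

lemma finite_int_polys_bounded:
  "finite {p :: int poly. degree p \<le> d \<and> (\<forall>i. \<bar>coeff p i\<bar> \<le> B)}" (is "finite ?S")
proof (rule finite_subset)
  let ?L = "{xs. set xs \<subseteq> {-B..B} \<and> length xs \<le> Suc d}"
  show "?S \<subseteq> Poly ` ?L"
  proof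
    fix p assume p: "p \<in> ?S"
    have "set (coeffs p) \<subseteq> {-B..B}"
    proof
      fix x assume "x \<in> set (coeffs p)"
      then obtain i where "x = coeff p i"
        by (auto simp: coeffs_def split: if_splits)
      moreover have "\<bar>coeff p i\<bar> \<le> B" using p by blast
      ultimately show "x \<in> {-B..B}" by auto
    qed
    moreover have "length (coeffs p) \<le> Suc d"
      using p by (simp add: coeffs_def)
    ultimately have "coeffs p \<in> ?L" by simp
    then show "p \<in> Poly ` ?L"
      by (intro image_eqI[of _ _ "coeffs p"]) simp_all
  qed
  show "finite (Poly ` ?L)"
    by (intro finite_imageI finite_lists_length_le) simp
qed

lemma lead_coeff_dvd_monic:
  fixes p q :: "int poly"
  assumes "p dvd q" and "lead_coeff q = 1"
  shows "\<bar>lead_coeff p\<bar> = 1"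
proof -
  obtain r where "q = p * r" using assms(1) by (rule dvdE)
  then have "lead_coeff p * lead_coeff r = 1" using assms(2) by (simp add: lead_coeff_mult)
  then show ?thesis by (auto simp: zmult_eq_1_iff)
qed

lemma of_int_poly_factorized:
  fixes p :: "int poly"
  obtains as :: "complex list" where "length as = degree p"
    and "of_int_poly p = Polynomial.smult (of_int (lead_coeff p)) (\<Prod>a\<leftarrow>as. [:- a, 1:])"
    and "\<And>a. a \<in> set as \<Longrightarrow> poly (of_int_poly p) a = 0"
proof -
  let ?q = "of_int_poly p :: complex poly"
  have q: "degree ?q = degree p" "lead_coeff ?q = of_int (lead_coeff p)"
    by simp_all
  obtain as where "Polynomial.smult (lead_coeff ?q) (\<Prod>a\<leftarrow>as. [:- a, 1:]) = ?q"
    and 2: "length as = degree p"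
    using fundamental_theorem_algebra_factorized[of ?q] q(1) by metis
  then have 1: "?q = Polynomial.smult (of_int (lead_coeff p)) (\<Prod>a\<leftarrow>as. [:- a, 1:])"
    by (simp only: q(2))
  have "poly (of_int_poly p) a = 0" if "a \<in> set as" for a
    unfolding 1 using that by (simp add: poly_prod_list prod_list_zero_iff image_iff)
  with 2 1 show thesis by (rule that)
qed

lemma poly_of_int_dvd:
  fixes z :: complex
  assumes "p dvd q" and "poly (of_int_poly p) z = 0"
  shows "poly (of_int_poly q) z = 0"
proof -
  obtain r where "q = p * r" using assms(1) by (rule dvdE)
  then show ?thesis using assms(2) by (simp add: of_int_poly_hom.hom_mult)
qed

lemma poly_power_minus_const:
  "poly (of_int_poly (monom 1 n - [:a:])) z = z ^ n - (of_int a :: complex)"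
  by (simp add: hom_distribs poly_monom)

lemma lead_coeff_power_minus_const:
  assumes "n > 0"
  shows "lead_coeff (monom 1 n - [:a :: int:]) = 1"
proof -
  have "degree (monom 1 n - [:a:]) = n"
    using assms by (subst diff_conv_add_uminus, subst degree_add_eq_left) (simp_all add: degree_monom_eq)
  then show ?thesis
    using assms by (simp add: coeff_pCons split: nat.split)
qed

text \<open>
  Being a root of some nonzero integer polynomial of degree at most \<open>d\<close> means having degree at
  most \<open>d\<close> over the rationals; no leading coefficient is prescribed, because the polynomials that
  arise below by rescaling a characteristic polynomial are not monic.
\<close>

definition roots_of_unity_deg :: "nat \<Rightarrow> complex set" where
  "roots_of_unity_deg d = {w. (\<exists>n>0. w ^ n = 1) \<and>
     (\<exists>g :: int poly. g \<noteq> 0 \<and> degree g \<le> d \<and> poly (of_int_poly g) w = 0)}"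

text \<open>
  The minimal polynomial of such a root of unity divides some \<open>X ^ n - 1\<close>. So its leading
  coefficient is \<open>\<plusminus>1\<close> and its roots lie on the unit circle, which bounds its coefficients by
  \<open>2 ^ d\<close>, whatever \<open>n\<close> is.
\<close>

lemma finite_roots_of_unity_deg: "finite (roots_of_unity_deg d)"
proof (rule finite_subset)
  let ?S = "{p :: int poly. degree p \<le> d \<and> (\<forall>i. \<bar>coeff p i\<bar> \<le> 2 ^ d)} - {0}"
  show "roots_of_unity_deg d \<subseteq> (\<Union>p\<in>?S. {w. poly (of_int_poly p) w = 0})"
  proof
    fix w assume "w \<in> roots_of_unity_deg d"
    then obtain n and g :: "int poly" where n: "n > 0" "w ^ n = 1"
      and g: "g \<noteq> 0" "degree g \<le> d" "poly (of_int_poly g) w = 0"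
      by (auto simp: roots_of_unity_deg_def)
    obtain p where p: "content p = 1" "poly (of_int_poly p) w = 0"
      and dvd: "\<And>q. poly (of_int_poly q) w = 0 \<Longrightarrow> p dvd q"
      using minimal_int_poly[OF g(1,3)] by blast
    have "p dvd g" using dvd g by blast
    then have deg: "degree p \<le> d"
      using g dvd_imp_degree_le le_trans by blast
    have unity: "p dvd monom 1 n - [:1:]"
      by (rule dvd) (use n in \<open>simp only: poly_power_minus_const, simp\<close>)
    have lc: "\<bar>lead_coeff p\<bar> = 1"
      using unity lead_coeff_power_minus_const[OF n(1)] by (rule lead_coeff_dvd_monic)
    obtain as where as: "length as = degree p"
      "of_int_poly p = Polynomial.smult (of_int (lead_coeff p)) (\<Prod>a\<leftarrow>as. [:- a, 1 :: complex:])"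
      "\<And>a. a \<in> set as \<Longrightarrow> poly (of_int_poly p) a = 0"
      using of_int_poly_factorized by blast
    have "norm a \<le> 1" if "a \<in> set as" for a
    proof -
      have "a ^ n = 1"
        using poly_of_int_dvd[OF unity as(3)[OF that]] unfolding poly_power_minus_const by simp
      then have "norm a ^ n = 1" by (metis norm_one norm_power)
      then show ?thesis
        using n(1) power_eq_imp_eq_base[of "norm a" n 1] by simp
    qed
    then have bd: "norm (coeff (\<Prod>a\<leftarrow>as. [:- a, 1:]) i) \<le> 2 ^ degree p" for i
      using norm_coeff_prod_linear_le as(1) by metis
    have "\<bar>coeff p i\<bar> \<le> 2 ^ d" for i
    proof -
      have "of_int (coeff p i) = coeff (of_int_poly p :: complex poly) i"
        by simp
      also have "\<dots> = of_int (lead_coeff p) * coeff (\<Prod>a\<leftarrow>as. [:- a, 1:]) i"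
        by (simp only: as(2) coeff_smult)
      finally have "norm (of_int (coeff p i) :: complex) \<le> 2 ^ degree p"
        using lc bd[of i] by (simp only: norm_mult norm_of_int flip: of_int_abs)
      also have "\<dots> \<le> 2 ^ d" using deg by simp
      finally have "real_of_int \<bar>coeff p i\<bar> \<le> real_of_int (2 ^ d)" by simp
      then show ?thesis by (simp only: of_int_le_iff)
    qed
    then show "w \<in> (\<Union>p\<in>?S. {w. poly (of_int_poly p) w = 0})"
      using p deg by (intro UN_I[of p]) auto
  qed
  have "finite {w. poly (of_int_poly p :: complex poly) w = 0}" if "p \<in> ?S" for p
    using that by (intro poly_roots_finite) simp
  then show "finite (\<Union>p\<in>?S. {w. poly (of_int_poly p :: complex poly) w = 0})"
    using finite_int_polys_bounded by (intro finite_UN_I finite_Diff) simp_all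
qed

lemma common_exponent_roots_of_unity:
  obtains M where "M > 0" and "\<And>w. w \<in> roots_of_unity_deg d \<Longrightarrow> w ^ M = 1"
proof -
  have "\<forall>w\<in>roots_of_unity_deg d. \<exists>n>0. w ^ n = 1"
    by (auto simp: roots_of_unity_deg_def)
  then obtain n where n: "\<And>w. w \<in> roots_of_unity_deg d \<Longrightarrow> n w > 0 \<and> w ^ n w = 1"
    by metis
  let ?M = "\<Prod>w\<in>roots_of_unity_deg d. n w"
  have "w ^ ?M = 1" if w: "w \<in> roots_of_unity_deg d" for w
  proof -
    have "n w dvd ?M" using finite_roots_of_unity_deg w by (rule dvd_prodI)
    then show ?thesis using n[OF w] by (metis dvdE power_mult power_one)
  qed
  moreover have "?M > 0" using n by (intro prod_pos) auto
  ultimately show thesis by (rule that[rotated])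
qed

section \<open>Algebraic integers with an integer power\<close>

text \<open>
  Take \<open>k\<close> to be the degree and \<open>c\<close> the constant coefficient of the minimal polynomial of \<open>z\<close>.
  Up to sign, \<open>c\<close> is the product of \<open>k\<close> roots whose \<open>n\<close>-th powers all equal \<open>a = z ^ n\<close>.
  The even exponent \<open>2 * n\<close> makes all signs disappear, so that \<open>c\<close> and \<open>z ^ k\<close> have the same
  \<open>2 * n\<close>-th power.
\<close>

lemma power_degree_eq_int_times_root_of_unity:
  fixes z :: complex
  assumes f: "lead_coeff f = 1" "poly (of_int_poly f) z = 0"
    and "z \<noteq> 0" "n > 0" "z ^ n = of_int a"
  obtains k c w where "0 < k" and "k \<le> degree f" and "c \<noteq> (0::int)"
    and "z ^ k = of_int c * w" and "w ^ (2 * n) = 1"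
proof -
  have "f \<noteq> 0" using f by auto
  then obtain p where p: "content p = 1" "poly (of_int_poly p) z = 0"
      and dvd: "\<And>q. poly (of_int_poly q) z = 0 \<Longrightarrow> p dvd q"
    using minimal_int_poly[OF _ f(2)] by blast
  have pf: "p dvd f" using dvd f by blast
  have deg: "degree p \<le> degree f"
    using pf \<open>f \<noteq> 0\<close> by (rule dvd_imp_degree_le)
  have pow: "p dvd monom 1 n - [:a:]"
    by (rule dvd) (use assms in \<open>simp only: poly_power_minus_const, simp\<close>)
  have "\<bar>lead_coeff p\<bar> = 1" using pf f(1) by (rule lead_coeff_dvd_monic)
  then have lc: "(lead_coeff p)\<^sup>2 = 1" by (metis power2_abs one_power2)
  obtain as where as: "length as = degree p"
      "of_int_poly p = Polynomial.smult (of_int (lead_coeff p)) (\<Prod>a\<leftarrow>as. [:- a, 1 :: complex:])"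
      "\<And>a. a \<in> set as \<Longrightarrow> poly (of_int_poly p) a = 0"
    using of_int_poly_factorized by blast
  have roots: "b ^ n = of_int a" if "b \<in> set as" for b
    using poly_of_int_dvd[OF pow as(3)[OF that]] unfolding poly_power_minus_const by simp
  \<comment> \<open>Stated for arbitrary lists of roots so that the induction on the list goes through.\<close>
  have prod: "(poly (\<Prod>a\<leftarrow>bs. [:- a, 1:]) 0) ^ (2 * n) = (of_int a :: complex) ^ (2 * length bs)"
    if "set bs \<subseteq> set as" for bs
    using that
  proof (induction bs)
    case (Cons b bs)
    have "(- b) ^ (2 * n) = (b ^ n) ^ 2"
      by (simp add: power_mult) (simp add: mult.commute flip: power_mult)
    also have "\<dots> = of_int a ^ 2"
      using roots[of b] Cons.prems by simp
    finally show ?case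
      using Cons by (simp add: power_mult_distrib power_add power2_eq_square)
  qed simp
  define k where "k = degree p"
  define c where "c = poly p 0"
  have "of_int c = poly (of_int_poly p) (0 :: complex)"
    unfolding c_def by (simp add: poly_0_coeff_0)
  also have "\<dots> = of_int (lead_coeff p) * poly (\<Prod>a\<leftarrow>as. [:- a, 1:]) 0"
    by (simp only: as(2) poly_smult)
  finally have "(of_int c :: complex) ^ (2 * n) =
      of_int (lead_coeff p) ^ (2 * n) * poly (\<Prod>a\<leftarrow>as. [:- a, 1:]) 0 ^ (2 * n)"
    by (simp only: power_mult_distrib)
  also have "of_int (lead_coeff p) ^ (2 * n) = (1 :: complex)"
    by (simp only: power_mult lc of_int_1 power_one flip: of_int_power)
  also have "poly (\<Prod>a\<leftarrow>as. [:- a, 1:]) 0 ^ (2 * n) = (z ^ n) ^ (2 * k)"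
    by (simp only: prod[OF order_refl] as(1) k_def assms)
  also have "1 * (z ^ n) ^ (2 * k) = (z ^ n) ^ (2 * k)" by (rule mult_1)
  also have "\<dots> = (z ^ k) ^ (2 * n)"
    by (simp only: power_mult[symmetric] mult.assoc mult.left_commute mult.commute)
  finally have c: "(of_int c :: complex) ^ (2 * n) = (z ^ k) ^ (2 * n)" .
  have c0: "c \<noteq> 0"
    using c \<open>z \<noteq> 0\<close> \<open>n > 0\<close> by (auto simp: zero_power)
  have "k > 0"
  proof (rule ccontr)
    assume "\<not> k > 0"
    then obtain b where "p = [:b:]" by (auto simp: k_def elim: degree_eq_zeroE)
    then show False using p by auto
  qed
  moreover have "k \<le> degree f" using deg by (simp add: k_def)
  moreover have "(z ^ k / of_int c) ^ (2 * n) = 1"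
    using c c0 \<open>z \<noteq> 0\<close> by (simp add: power_divide)
  ultimately show thesis using c0 by (intro that[of k c "z ^ k / of_int c"]) auto
qed

section \<open>Eigenvalues of powers of a matrix\<close>

lemma upper_triangular_mult:
  fixes A B :: "'a :: semiring_1 mat"
  assumes A: "A \<in> carrier_mat n n" "upper_triangular A"
    and B: "B \<in> carrier_mat n n" "upper_triangular B"
  shows "upper_triangular (A * B)"
    and "i < n \<Longrightarrow> (A * B) $$ (i, i) = A $$ (i, i) * B $$ (i, i)"
proof -
  have entry: "(A * B) $$ (i, j) = (\<Sum>l\<in>{0..<n}. A $$ (i, l) * B $$ (l, j))"
    if "i < n" "j < n" for i j
    using that A B by (simp add: scalar_prod_def)
  have zero: "A $$ (i, l) * B $$ (l, j) = 0" if "i < n" "l < n" "l < i \<or> j < l" for i j l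
    using that A B upper_triangularD[of A l i] upper_triangularD[of B j l] by auto
  show "upper_triangular (A * B)"
  proof
    fix i j assume ij: "j < i" "i < dim_row (A * B)"
    then have "i < n" "j < n" using A by simp_all
    moreover have "A $$ (i, l) * B $$ (l, j) = 0" if "l < n" for l
      using zero[OF \<open>i < n\<close> that, of j] ij by linarith
    ultimately show "(A * B) $$ (i, j) = 0"
      by (simp add: entry)
  qed
  show "(A * B) $$ (i, i) = A $$ (i, i) * B $$ (i, i)" if "i < n"
  proof -
    have "(\<Sum>l\<in>{0..<n}. A $$ (i, l) * B $$ (l, i)) = (\<Sum>l\<in>{i}. A $$ (i, l) * B $$ (l, i))"
      using that zero[of i _ i] by (intro sum.mono_neutral_right) (auto simp: neq_iff)
    then show ?thesis using entry that by simp
  qed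
qed

lemma upper_triangular_pow:
  fixes A :: "'a :: semiring_1 mat"
  assumes A: "A \<in> carrier_mat n n" "upper_triangular A"
  shows "upper_triangular (A ^\<^sub>m e) \<and> (\<forall>i<n. (A ^\<^sub>m e) $$ (i, i) = (A $$ (i, i)) ^ e)"
proof (induction e)
  case 0
  then show ?case using A by simp
next
  case (Suc e)
  then show ?case
    using upper_triangular_mult[of "A ^\<^sub>m e" n A] A by (auto simp: power_commutes)
qed

lemma eigenvalue_upper_triangular:
  fixes T :: "'a :: field mat"
  assumes "T \<in> carrier_mat n n" "upper_triangular T"
  shows "eigenvalue T z \<longleftrightarrow> (\<exists>i<n. z = T $$ (i, i))"
proof -
  have "eigenvalue T z \<longleftrightarrow> poly (\<Prod>a\<leftarrow>diag_mat T. [:- a, 1:]) z = 0"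
    using assms by (simp add: eigenvalue_root_char_poly char_poly_upper_triangular)
  also have "\<dots> \<longleftrightarrow> z \<in> set (diag_mat T)"
    by (auto simp: poly_prod_list prod_list_zero_iff)
  finally show ?thesis using assms by (auto simp: diag_mat_def)
qed

text \<open>
  By Schur decomposition it suffices to look at upper triangular matrices, where the eigenvalues
  are the diagonal entries and powers act on the diagonal entrywise.
\<close>

lemma eigenvalue_pow_mat_iff:
  fixes A :: "complex mat"
  assumes A: "A \<in> carrier_mat n n"
  shows "eigenvalue (A ^\<^sub>m e) z \<longleftrightarrow> (\<exists>x. eigenvalue A x \<and> z = x ^ e)"
proof -
  obtain as where "char_poly A = (\<Prod>a\<leftarrow>as. [:- a, 1:])"
    using char_poly_factorized[OF A] by blast
  then obtain T where T: "T \<in> carrier_mat n n" "upper_triangular T" and sim: "similar_mat A T"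
    using schur_decomposition_exists[OF A] by blast
  from sim have sim_pow: "similar_mat (A ^\<^sub>m e) (T ^\<^sub>m e)"
    unfolding similar_mat_def using similar_mat_wit_pow by blast
  have "eigenvalue A x \<longleftrightarrow> eigenvalue T x" for x
    using A T char_poly_similar[OF sim] by (simp add: eigenvalue_root_char_poly)
  moreover have "eigenvalue (A ^\<^sub>m e) z \<longleftrightarrow> eigenvalue (T ^\<^sub>m e) z"
    using A T char_poly_similar[OF sim_pow] by (simp add: eigenvalue_root_char_poly[of _ n])
  moreover have "eigenvalue (T ^\<^sub>m e) z \<longleftrightarrow> (\<exists>i<n. z = T $$ (i, i) ^ e)"
    using eigenvalue_upper_triangular[of "T ^\<^sub>m e" n z] upper_triangular_pow[OF T, of e] T(1) by auto
  ultimately show ?thesis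
    using eigenvalue_upper_triangular[OF T] by auto
qed

lemma has_integer_eigenvalues_pow_iff:
  assumes A: "A \<in> carrier_mat d d"
  shows "has_integer_eigenvalues (A ^\<^sub>m n) \<longleftrightarrow>
    (\<forall>x. eigenvalue (map_mat complex_of_int A) x \<longrightarrow> x ^ n \<in> \<int>)"
proof -
  have "map_mat complex_of_int (A ^\<^sub>m n) = map_mat complex_of_int A ^\<^sub>m n"
    by (rule of_int_hom.mat_hom_pow[OF A])
  then show ?thesis
    using eigenvalue_pow_mat_iff[of "map_mat complex_of_int A" d n] A
    by (auto simp: has_integer_eigenvalues_def)
qed

section \<open>A uniform exponent\<close>

text \<open>
  The exponent in the conclusion does not involve \<open>n\<close>: the hypothesis on \<open>n\<close> only guarantees that
  each nonzero eigenvalue has a power with exponent at most \<open>d\<close> that is an integer times a root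
  of unity.
\<close>

lemma uniform_integral_power:
  assumes M: "\<And>w. w \<in> roots_of_unity_deg d \<Longrightarrow> w ^ M = 1" "M > 0"
    and A: "A \<in> carrier_mat d d" and n: "n > 0" "has_integer_eigenvalues (A ^\<^sub>m n)"
  shows "has_integer_eigenvalues (A ^\<^sub>m (fact d * M))"
  unfolding has_integer_eigenvalues_pow_iff[OF A]
proof (intro allI impI)
  fix x assume x: "eigenvalue (map_mat complex_of_int A) x"
  show "x ^ (fact d * M) \<in> \<int>"
  proof (cases "x = 0")
    case True
    then show ?thesis using M(2) by (simp add: zero_power)
  next
    case False
    have root: "poly (of_int_poly (char_poly B)) y = 0"
      if "eigenvalue (map_mat complex_of_int B) y" "B \<in> carrier_mat d d" for B y
      using that by (metis eigenvalue_root_char_poly map_carrier_mat of_int_hom.char_poly_hom)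
    have deg: "degree (char_poly B) = d \<and> lead_coeff (char_poly B) = 1"
      if "B \<in> carrier_mat d d" for B :: "int mat"
      using degree_monic_char_poly[OF that] by auto
    obtain a where a: "x ^ n = of_int a"
      using n x has_integer_eigenvalues_pow_iff[OF A] by (metis Ints_cases)
    obtain k c w where k: "0 < k" "k \<le> d" and c: "c \<noteq> (0::int)"
      and xk: "x ^ k = of_int c * w" and w: "w ^ (2 * n) = 1"
      using power_degree_eq_int_times_root_of_unity[OF _ root[OF x A] False n(1) a] deg[OF A] by metis
    \<comment> \<open>Since \<open>c * w = x ^ k\<close> is an eigenvalue of \<open>A ^ k\<close>, substituting \<open>c * X\<close> into the
      characteristic polynomial of \<open>A ^ k\<close> gives an integer polynomial of degree \<open>d\<close> with root \<open>w\<close>.\<close>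
    define g where "g = pcompose (char_poly (A ^\<^sub>m k)) [:0, c:]"
    have Ak: "A ^\<^sub>m k \<in> carrier_mat d d" using A by simp
    have "eigenvalue (map_mat complex_of_int (A ^\<^sub>m k)) (x ^ k)"
      unfolding of_int_hom.mat_hom_pow[OF A, of k]
      using eigenvalue_pow_mat_iff[of "map_mat complex_of_int A" d k "x ^ k"] x A by auto
    then have "poly (of_int_poly (char_poly (A ^\<^sub>m k))) (of_int c * w) = 0"
      using root Ak xk by metis
    then have gw: "poly (of_int_poly g) w = 0"
      by (simp add: g_def of_int_hom.map_poly_pcompose poly_pcompose hom_distribs mult.commute)
    have dg: "degree g = d"
      using c deg[OF Ak] by (simp add: g_def degree_pcompose)
    then have "g \<noteq> 0" using k by auto
    then have "w \<in> roots_of_unity_deg d"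
      using gw dg w n(1) by (auto simp: roots_of_unity_deg_def intro!: exI[of _ "2 * n"] exI[of _ g])
    then have "x ^ (k * M) = of_int (c ^ M)"
      using M by (simp add: power_mult xk power_mult_distrib)
    moreover obtain m where "fact d = k * m"
      using dvd_fact[of k d] k by (auto elim: dvdE)
    ultimately have "x ^ (fact d * M) = of_int ((c ^ M) ^ m)"
      by (metis mult.assoc mult.commute of_int_power power_mult)
    then show ?thesis by simp
  qed
qed

theorem proposition3p5:
  fixes d :: nat
  assumes "d \<ge> 1"
  shows "max_integral_power d < \<infinity>"
proof -
  obtain M where M: "M > 0" "\<And>w. w \<in> roots_of_unity_deg d \<Longrightarrow> w ^ M = 1"
    using common_exponent_roots_of_unity by blast
  have "min_integral_power A \<le> fact d * M" if "A \<in> eventually_integral_mats d" for A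
    using that uniform_integral_power[OF M(2,1)] M(1)
    by (auto simp: eventually_integral_mats_def min_integral_power_def intro!: Least_le)
  then have "max_integral_power d \<le> enat (fact d * M)"
    unfolding max_integral_power_def by (intro SUP_least) simp
  then show ?thesis
    by (rule le_less_trans) simp
qed

end
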